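(* In the payment network creation game with $n$ players, betweenness weight $b\ge 0$ and closeness weight $c$ with $c>1$ and $c>\frac12+b$, the price of anarchy is $\mathrm{PoA}=1$.
   Context: Payment network creation game. There are $n\ge 2$ players $[n]=\{0,1,\dots,n-1\}$. A strategy of player $u$ is a set $s_u\subseteq [n]\setminus\{u\}$ (the players to whom $u$ opens a channel). A strategy combination is $s=(s_0,\dots,s_{n-1})$, and $G[s]$ is the undirected simple graph on $[n]$ in which $u,v$ are adjacent iff $v\in s_u$ or $u\in s_v$. With weights $b\ge 0$ and $c>0$, the cost of $u$ is $$\mathrm{cost}_u(s)=|s_u|+b\cdot \mathrm{betweenness}_u(s)+c\cdot \mathrm{closeness}_u(s),$$ $$\mathrm{betweenness}_u(s)=(n-1)(n-2)-\sum_{\substack{(i,j)\in[n]^2:\ i\ne j,\ i\neq u,\ j\ne u,\\ m(i,j)>0}}\frac{m_u(i,j)}{m(i,j)},\qquad \mathrm{closeness}_u(s)=\sum_{v\in[n]\setminus\{u\}}\bigl(d_{G[s]}(u,v)-1\bigr).$$ The sum in the betweenness runs over ordered pairs; $m(i,j)$ is the number of shortest paths between $i$ and $j$ in $G[s]$ and $m_u(i,j)$ the number of those passing through $u$; $d_{G[s]}$ is graph distance, equal to $\infty$ between different components. The social cost is $\mathrm{cost}(s)=\sum_{u}\mathrm{cost}_u(s)$. A strategy combination is a Nash equilibrium if no player can strictly decrease her cost by unilaterally changing her strategy; equilibrium graphs are taken to be connected (a player's cost is infinite in a disconnected graph, and disconnected strategy combinations are not regarded as equilibria). With $S$ the set of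 all strategy combinations and $N$ the set of Nash equilibria, $\mathrm{PoA}=\dfrac{\max_{s\in N}\mathrm{cost}(s)}{\min_{s\in S}\mathrm{cost}(s)}$. *)

theory Defs
  imports
    "HOL-Library.FuncSet"
    "Graph_Theory.Shortest_Path"
    "Graph_Theory.Pair_Digraph"
    "Graph_Theory.Digraph_Component"
begin

definition strategies :: "nat \<Rightarrow> nat \<Rightarrow> nat set set" where
  "strategies n u = Pow ({..<n} - {u})"

definition strategy_combinations :: "nat \<Rightarrow> (nat \<Rightarrow> nat set) set" where
  "strategy_combinations n = (\<Pi>\<^sub>E u\<in>{..<n}. strategies n u)"

lemma finite_strategy_combinations: "finite (strategy_combinations n)"
  by (auto simp: strategy_combinations_def strategies_def intro: finite_PiE)

(* An undirected simple graph is represented, as usual in Graph_Theory, by the loop-free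
   symmetric digraph with both arcs (u,v) and (v,u) for every edge {u,v}. A path between two
   fixed vertices of the undirected graph is then exactly a directed path between them. *)
definition network :: "nat \<Rightarrow> (nat \<Rightarrow> nat set) \<Rightarrow> nat pair_pre_digraph" where
  "network n s = \<lparr> pverts = {..<n},
     parcs = {(u, v). u < n \<and> v < n \<and> u \<noteq> v \<and> (v \<in> s u \<or> u \<in> s v)} \<rparr>"

lemma graph_network: "graph (with_proj (network n s))"
proof -
  have "finite {(u, v). u < n \<and> v < n \<and> u \<noteq> v \<and> (v \<in> s u \<or> u \<in> s v)}"
    by (rule finite_subset[of _ "{..<n} \<times> {..<n}"]) auto
  then show ?thesis
    by unfold_locales
      (auto simp: network_def arc_to_ends_def symmetric_def intro!: symI)
qed

(* The infimum of the lengths of the walks from i to j: it is attained by a path if j is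
   reachable from i, and is \<infinity> otherwise. *)
definition distance :: "nat \<Rightarrow> (nat \<Rightarrow> nat set) \<Rightarrow> nat \<Rightarrow> nat \<Rightarrow> ereal" where
  "distance n s i j = wf_digraph.\<mu> (with_proj (network n s)) (\<lambda>_. 1) i j"

definition shortest_paths :: "nat \<Rightarrow> (nat \<Rightarrow> nat set) \<Rightarrow> nat \<Rightarrow> nat \<Rightarrow> (nat \<times> nat) list set" where
  "shortest_paths n s i j =
     {p. pre_digraph.apath (with_proj (network n s)) i p j \<and> ereal (real (length p)) = distance n s i j}"

definition shortest_paths_through ::
    "nat \<Rightarrow> (nat \<Rightarrow> nat set) \<Rightarrow> nat \<Rightarrow> nat \<Rightarrow> nat \<Rightarrow> (nat \<times> nat) list set" where
  "shortest_paths_through n s u i j =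
     {p \<in> shortest_paths n s i j. u \<in> set (pre_digraph.awalk_verts (with_proj (network n s)) i p)}"

definition betweenness :: "nat \<Rightarrow> (nat \<Rightarrow> nat set) \<Rightarrow> nat \<Rightarrow> real" where
  "betweenness n s u = (real n - 1) * (real n - 2) -
     (\<Sum>(i, j) \<in> {(i, j). i < n \<and> j < n \<and> i \<noteq> j \<and> i \<noteq> u \<and> j \<noteq> u \<and> card (shortest_paths n s i j) > 0}.
        real (card (shortest_paths_through n s u i j)) / real (card (shortest_paths n s i j)))"

definition closeness :: "nat \<Rightarrow> (nat \<Rightarrow> nat set) \<Rightarrow> nat \<Rightarrow> ereal" where
  "closeness n s u = (\<Sum>v \<in> {..<n} - {u}. distance n s u v - 1)"

definition cost :: "nat \<Rightarrow> real \<Rightarrow> real \<Rightarrow> (nat \<Rightarrow> nat set) \<Rightarrow> nat \<Rightarrow> ereal" where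
  "cost n b c s u =
     ereal (real (card (s u))) + ereal b * ereal (betweenness n s u) + ereal c * closeness n s u"

definition social_cost :: "nat \<Rightarrow> real \<Rightarrow> real \<Rightarrow> (nat \<Rightarrow> nat set) \<Rightarrow> ereal" where
  "social_cost n b c s = (\<Sum>u<n. cost n b c s u)"

(* By convention equilibria are connected. For c > 0 the explicit condition is redundant: in a
   disconnected network all costs are \<infinity>, and any player can make her cost finite by
   opening channels to everyone. The qualified name selects graph, not topological,
   connectedness. *)
definition nash_equilibria :: "nat \<Rightarrow> real \<Rightarrow> real \<Rightarrow> (nat \<Rightarrow> nat set) set" where
  "nash_equilibria n b c =
     {s \<in> strategy_combinations n.
        Digraph_Component.connected (with_proj (network n s)) \<and>
        (\<forall>u<n. \<forall>t \<in> strategies n u. \<not> cost n b c (s(u := t)) u < cost n b c s u)}"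

(* Max of the empty set is unspecified, so an equation for the price of anarchy is only
   meaningful, and only provable, if an equilibrium exists. *)
definition price_of_anarchy :: "nat \<Rightarrow> real \<Rightarrow> real \<Rightarrow> ereal" where
  "price_of_anarchy n b c =
     Max (social_cost n b c ` nash_equilibria n b c) /
     Min (social_cost n b c ` strategy_combinations n)"

end

(* With c > 1 every missing channel is worth opening, since it lowers the opener's closeness cost
   by at least c and never raises her betweenness cost; and a channel opened from both sides is worth
   closing. So equilibria are exactly complete graphs with every edge paid for once, and they all
   have the same social cost. Conversely, in a connected network the internal vertices of shortest
   paths turn the total betweenness cost into b n (n-1) (n-2) - b * sum (d(i,j) - 1), so the social
   cost is at least |E| + b n (n-1) (n-2) + (c - b) * sum (d(i,j) - 1), summed over ordered pairs.
   Each missing edge contributes two ordered pairs with d >= 2, hence at least 2 (c - b) > 1, which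
   is more than the edge would have cost. *)

theory Submission
  imports Defs
begin

section \<open>Walks, paths and distances in the network\<close>

abbreviation adjacent :: "nat \<Rightarrow> (nat \<Rightarrow> nat set) \<Rightarrow> nat \<Rightarrow> nat \<Rightarrow> bool" where
  "adjacent n s u v \<equiv> (u, v) \<in> parcs (network n s)"

abbreviation walk :: "nat \<Rightarrow> (nat \<Rightarrow> nat set) \<Rightarrow> nat \<Rightarrow> (nat \<times> nat) list \<Rightarrow> nat \<Rightarrow> bool" where
  "walk n s \<equiv> pre_digraph.awalk (with_proj (network n s))"

abbreviation path :: "nat \<Rightarrow> (nat \<Rightarrow> nat set) \<Rightarrow> nat \<Rightarrow> (nat \<times> nat) list \<Rightarrow> nat \<Rightarrow> bool" where
  "path n s \<equiv> pre_digraph.apath (with_proj (network n s))"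

definition finite_distances :: "nat \<Rightarrow> (nat \<Rightarrow> nat set) \<Rightarrow> bool" where
  "finite_distances n s \<longleftrightarrow> (\<forall>i<n. \<forall>j<n. distance n s i j \<noteq> \<infinity>)"

definition distinct_pairs :: "nat \<Rightarrow> (nat \<times> nat) set" where
  "distinct_pairs n = {(i, j). i < n \<and> j < n \<and> i \<noteq> j}"

interpretation network: graph "with_proj (network n s)" for n s
  by (rule graph_network)

lemma pverts_network [simp]: "pverts (network n s) = {..<n}"
  by (simp add: network_def)

lemma adjacent_iff: "adjacent n s u v \<longleftrightarrow> u < n \<and> v < n \<and> u \<noteq> v \<and> (v \<in> s u \<or> u \<in> s v)"
  by (simp add: network_def)

lemma walk_iff: "walk n s i p j \<longleftrightarrow> i < n \<and> set p \<subseteq> parcs (network n s) \<and> pcas i p j"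
  by (simp add: pre_digraph.awalk_def cas_with_proj_eq)

lemma path_iff: "path n s i p j \<longleftrightarrow> walk n s i p j \<and> distinct (pawalk_verts i p)"
  by (simp add: pre_digraph.apath_def awalk_verts_with_proj_eq)

lemma awalk_cost_unit: "network.awalk_cost (\<lambda>_. 1) p = real (length p)"
  by (induct p) auto

lemma distance_Inf: "distance n s i j = (INF p \<in> {p. walk n s i p j}. ereal (real (length p)))"
  by (simp add: distance_def network.\<mu>_def awalk_cost_unit)

lemma distance_le: "walk n s i p j \<Longrightarrow> distance n s i j \<le> real (length p)"
  by (auto simp: distance_Inf intro: INF_lower2)

text \<open>Cutting the cycles out of a walk never lengthens it, so the infimum is already attained
  among the finitely many paths.\<close>

lemma distance_attained:
  assumes "distance n s i j \<noteq> \<infinity>"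
  obtains p where "path n s i p j" "distance n s i j = real (length p)"
proof -
  have "i \<rightarrow>\<^sup>*\<^bsub>with_proj (network n s)\<^esub> j"
    using assms by (simp add: distance_def less_top flip: network.\<mu>_reach_conv[of _ _ "\<lambda>_. 1"])
  from network.min_cost_awalk[OF this, of "\<lambda>_. 1"] that show ?thesis
    by (auto simp: distance_def awalk_cost_unit)
qed

lemma distance_adjacent_le: "adjacent n s i j \<Longrightarrow> distance n s i j \<le> 1"
  using distance_le[of n s i "[(i, j)]" j] by (auto simp: walk_iff adjacent_iff one_ereal_def)

text \<open>A walk between different players has an arc, and a walk with a single arc is an edge.
  Without any walk the infimum is \<infinity> and the bound still holds.\<close>

lemma distance_ge:
  assumes "i \<noteq> j"
  shows "distance n s i j \<ge> (if adjacent n s i j then 1 else 2)"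
  unfolding distance_Inf
proof (rule INF_greatest)
  fix p assume "p \<in> {p. walk n s i p j}"
  then have p: "walk n s i p j" by simp
  show "(if adjacent n s i j then 1 else 2) \<le> ereal (real (length p))"
  proof (cases p)
    case Nil
    with p assms show ?thesis by (simp add: walk_iff)
  next
    case (Cons e q)
    with p show ?thesis
      by (cases q; cases e) (auto simp: walk_iff one_ereal_def numeral_eq_ereal)
  qed
qed

lemma distance_adjacent: "adjacent n s i j \<Longrightarrow> distance n s i j = 1"
  using distance_adjacent_le[of i j n s] distance_ge[of i j n s]
  by (auto simp: adjacent_iff)

lemma finite_shortest_paths [simp]: "finite (shortest_paths n s i j)"
  by (rule finite_subset[OF _ network.apaths_finite]) (auto simp: shortest_paths_def)

lemma finite_shortest_paths_through [simp]: "finite (shortest_paths_through n s u i j)"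
  by (simp add: shortest_paths_through_def)

lemma shortest_paths_through_subset: "shortest_paths_through n s u i j \<subseteq> shortest_paths n s i j"
  by (auto simp: shortest_paths_through_def)

lemma shortest_paths_nonempty:
  "distance n s i j \<noteq> \<infinity> \<Longrightarrow> shortest_paths n s i j \<noteq> {}"
  by (auto simp: shortest_paths_def elim!: distance_attained)

lemma card_shortest_paths_pos:
  "distance n s i j \<noteq> \<infinity> \<Longrightarrow> 0 < card (shortest_paths n s i j)"
  by (simp add: card_gt_0_iff shortest_paths_nonempty)

section \<open>Connectedness and finite distances\<close>

lemma finite_distances_of_connected:
  assumes "Digraph_Component.connected (with_proj (network n s))"
  shows "finite_distances n s"
proof -
  have "strongly_connected (with_proj (network n s))"
    using assms network.sym_arcs by (rule network.symmetric_connected_imp_strongly_connected[rotated])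
  then show ?thesis
    using network.\<mu>_reach_conv[of n s "\<lambda>_. 1"]
    by (fastforce simp: finite_distances_def distance_def strongly_connected_def)
qed

text \<open>The hypothesis \<open>0 < n\<close> is there because connectedness includes a nonempty
  vertex set.\<close>

lemma connected_complete_network:
  assumes "0 < n" and "\<And>u v. (u, v) \<in> distinct_pairs n \<Longrightarrow> adjacent n s u v"
  shows "Digraph_Component.connected (with_proj (network n s))"
  unfolding connected_def
proof (rule strongly_connectedI)
  fix u v
  assume "u \<in> verts (with_proj (mk_symmetric (with_proj (network n s))))"
    and "v \<in> verts (with_proj (mk_symmetric (with_proj (network n s))))"
  then have "u < n" "v < n" by auto
  then have "u \<rightarrow>\<^sup>*\<^bsub>with_proj (network n s)\<^esub> v"
    using assms(2)[of u v] by (cases "u = v") (auto simp: distinct_pairs_def)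
  then show "u \<rightarrow>\<^sup>*\<^bsub>with_proj (mk_symmetric (with_proj (network n s)))\<^esub> v"
    by (rule network.reachable_mk_symmetricI)
qed (use assms(1) in auto)

subsection \<open>Betweenness\<close>

text \<open>The index set of the betweenness sum once all distances are finite: every pair then has
  a shortest path.\<close>

definition pairs_avoiding :: "nat \<Rightarrow> nat \<Rightarrow> (nat \<times> nat) set" where
  "pairs_avoiding n u = {x \<in> distinct_pairs n. fst x \<noteq> u \<and> snd x \<noteq> u}"

definition through_ratio :: "nat \<Rightarrow> (nat \<Rightarrow> nat set) \<Rightarrow> nat \<Rightarrow> nat \<times> nat \<Rightarrow> real" where
  "through_ratio n s u x = (case x of (i, j) \<Rightarrow>
     real (card (shortest_paths_through n s u i j)) / real (card (shortest_paths n s i j)))"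

lemma finite_distinct_pairs [simp]: "finite (distinct_pairs n)"
  by (rule finite_subset[of _ "{..<n} \<times> {..<n}"]) (auto simp: distinct_pairs_def)

lemma finite_pairs_avoiding [simp]: "finite (pairs_avoiding n u)"
  by (simp add: pairs_avoiding_def)

lemma distinct_pairs_Sigma: "distinct_pairs n = (SIGMA u:{..<n}. {..<n} - {u})"
  by (auto simp: distinct_pairs_def)

lemma card_distinct_pairs: "real (card (distinct_pairs n)) = real n * (real n - 1)"
  by (cases n) (simp_all add: distinct_pairs_Sigma algebra_simps)

lemma sum_distinct_pairs: "(\<Sum>u<n. \<Sum>v\<in>{..<n} - {u}. f u v) = (\<Sum>(u, v)\<in>distinct_pairs n. f u v)"
  by (simp add: distinct_pairs_Sigma sum.Sigma)

lemma betweenness_eq: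
  assumes "finite_distances n s"
  shows "betweenness n s u
    = (real n - 1) * (real n - 2) - (\<Sum>x\<in>pairs_avoiding n u. through_ratio n s u x)"
proof -
  have "{(i, j). i < n \<and> j < n \<and> i \<noteq> j \<and> i \<noteq> u \<and> j \<noteq> u \<and> card (shortest_paths n s i j) > 0}
      = pairs_avoiding n u"
    using assms card_shortest_paths_pos
    by (auto simp: pairs_avoiding_def distinct_pairs_def finite_distances_def)
  then show ?thesis
    by (simp add: betweenness_def through_ratio_def)
qed

text \<open>A path with l arcs visits l + 1 different vertices, two of which are its ends.\<close>

lemma card_inner_vertices:
  assumes p: "path n s i p j" and "i \<noteq> j"
  shows "real (card {u \<in> {..<n}. (i \<noteq> u \<and> j \<noteq> u) \<and> u \<in> set (pawalk_verts i p)}) = real (length p) - 1"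
proof -
  let ?V = "pawalk_verts i p"
  have "set ?V \<subseteq> {..<n}" "hd ?V = i" "last ?V = j"
    using p network.awalk_conv[of n s i p j]
    by (auto simp: path_iff awalk_verts_with_proj_eq)
  moreover have "length ?V = Suc (length p)" by (induct p arbitrary: i) auto
  moreover from this have "?V \<noteq> []" by auto
  ultimately have ends: "i \<in> set ?V" "j \<in> set ?V" and sub: "set ?V \<subseteq> {..<n}"
    and len: "length ?V = Suc (length p)"
    by (metis hd_in_set, metis last_in_set, auto)
  have "{u \<in> {..<n}. (i \<noteq> u \<and> j \<noteq> u) \<and> u \<in> set ?V} = set ?V - {i, j}"
    using sub by auto
  moreover have "card (set ?V) = Suc (length p)"
    using p len by (simp add: path_iff distinct_card)
  \<comment> \<open>Excludes the truncated subtraction \<open>Suc 0 - 2 = 0\<close>, where the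
    right-hand side would be -1.\<close>
  moreover have "length p \<noteq> 0"
    using p \<open>i \<noteq> j\<close> by (auto simp: path_iff walk_iff)
  ultimately show ?thesis
    using ends \<open>i \<noteq> j\<close> by (cases "length p") (simp_all add: card_Diff_subset)
qed

text \<open>A shortest path of length \<open>d\<close> has \<open>d - 1\<close> inner vertices, so the fractions of shortest
  paths through the individual vertices add up to \<open>d - 1\<close>.\<close>

lemma sum_through_ratio:
  assumes "i \<noteq> j" and d: "distance n s i j = ereal d"
  shows "(\<Sum>u\<in>{u\<in>{..<n}. i \<noteq> u \<and> j \<noteq> u}. through_ratio n s u (i, j)) = d - 1"
proof -
  let ?S = "shortest_paths n s i j"
  let ?U = "{u\<in>{..<n}. i \<noteq> u \<and> j \<noteq> u}"
  have "(\<Sum>u\<in>?U. real (card (shortest_paths_through n s u i j)))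
      = (\<Sum>u\<in>?U. \<Sum>p | p \<in> ?S \<and> u \<in> set (pawalk_verts i p). 1)"
    by (simp add: shortest_paths_through_def awalk_verts_with_proj_eq)
  \<comment> \<open>Double counting of the pairs of a shortest path and an inner vertex on
    it.\<close>
  also have "\<dots> = (\<Sum>p\<in>?S. \<Sum>u | u \<in> ?U \<and> u \<in> set (pawalk_verts i p). 1)"
    by (rule sum.swap_restrict) auto
  also have "\<dots> = (\<Sum>p\<in>?S. d - 1)"
  proof (rule sum.cong[OF refl])
    fix p assume "p \<in> ?S"
    then have "path n s i p j" "real (length p) = d"
      using d by (auto simp: shortest_paths_def)
    then show "(\<Sum>u | u \<in> ?U \<and> u \<in> set (pawalk_verts i p). 1) = d - 1"
      using card_inner_vertices[of n s i p j] \<open>i \<noteq> j\<close> by simp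
  qed
  finally have "(\<Sum>u\<in>?U. real (card (shortest_paths_through n s u i j))) = real (card ?S) * (d - 1)"
    by simp
  moreover have "0 < card ?S"
    using d by (simp add: card_shortest_paths_pos)
  ultimately show ?thesis
    by (simp add: through_ratio_def card_gt_0_iff flip: sum_divide_distrib)
qed

lemma distance_eq_ereal:
  assumes "distance n s i j \<noteq> \<infinity>"
  shows "distance n s i j = ereal (real_of_ereal (distance n s i j))"
  using assms by (metis distance_attained real_of_ereal.simps(1))

text \<open>After exchanging the sums over players and pairs, each pair collects the through ratios
  of all other players, which add up to its distance minus one.\<close>

lemma sum_betweenness:
  assumes "finite_distances n s"
  shows "(\<Sum>u<n. betweenness n s u) = real n * (real n - 1) * (real n - 2)
    - (\<Sum>(i, j)\<in>distinct_pairs n. real_of_ereal (distance n s i j) - 1)"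
proof -
  have "(\<Sum>u<n. \<Sum>x\<in>pairs_avoiding n u. through_ratio n s u x)
      = (\<Sum>x\<in>distinct_pairs n. \<Sum>u\<in>{u\<in>{..<n}. fst x \<noteq> u \<and> snd x \<noteq> u}. through_ratio n s u x)"
    unfolding pairs_avoiding_def by (rule sum.swap_restrict) auto
  also have "\<dots> = (\<Sum>(i, j)\<in>distinct_pairs n. real_of_ereal (distance n s i j) - 1)"
  proof (rule sum.cong[OF refl], safe)
    fix i j assume "(i, j) \<in> distinct_pairs n"
    then have "i \<noteq> j" "distance n s i j \<noteq> \<infinity>"
      using assms by (auto simp: distinct_pairs_def finite_distances_def)
    then show "(\<Sum>u\<in>{u\<in>{..<n}. fst (i, j) \<noteq> u \<and> snd (i, j) \<noteq> u}. through_ratio n s u (i, j))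
        = real_of_ereal (distance n s i j) - 1"
      using sum_through_ratio[OF _ distance_eq_ereal] by simp
  qed
  finally show ?thesis
    using assms by (simp add: betweenness_eq sum_subtractf)
qed

text \<open>Arcs are added at \<open>u\<close> only, so a walk avoiding \<open>u\<close> uses none
  of them. The complementary fraction, of shortest paths avoiding \<open>u\<close>, is compared:
  either it becomes 0, or the distance is unchanged, and then its numerator cannot grow and its
  denominator cannot shrink.\<close>

lemma through_ratio_mono:
  assumes "distance n s i j \<noteq> \<infinity>" and "distance n t i j \<noteq> \<infinity>" and "i \<noteq> u"
    and sub: "parcs (network n s) \<subseteq> parcs (network n t)"
    and at_u: "\<And>v w. adjacent n t v w \<Longrightarrow> v \<noteq> u \<Longrightarrow> w \<noteq> u \<Longrightarrow> adjacent n s v w"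
  shows "through_ratio n s u (i, j) \<le> through_ratio n t u (i, j)"
proof -
  have walk_mono: "walk n t v p w" if "walk n s v p w" for v p w
    using that sub by (auto simp: walk_iff)
  have avoid: "walk n s i p j" if "walk n t i p j" "u \<notin> set (pawalk_verts i p)" for p
  proof -
    have "fst e \<in> set (pawalk_verts v p) \<and> snd e \<in> set (pawalk_verts v p)" if "e \<in> set p" "pcas v p w" for e v w
      using that by (induct p arbitrary: v) (auto split: if_splits, (case_tac p; auto)+)
    then show ?thesis
      using that at_u by (fastforce simp: walk_iff)
  qed
  \<comment> \<open>The shortest paths that avoid \<open>u\<close>, in the smaller and in the larger
    network.\<close>
  define A B where "A = shortest_paths n s i j - shortest_paths_through n s u i j"
    and "B = shortest_paths n t i j - shortest_paths_through n t u i j"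
  let ?S = "shortest_paths n s i j" and ?T = "shortest_paths n t i j"
  have pos: "0 < card ?S" "0 < card ?T"
    using assms by (simp_all add: card_shortest_paths_pos)
  have eq: "through_ratio n s u (i, j) = 1 - card A / card ?S"
    "through_ratio n t u (i, j) = 1 - card B / card ?T"
    using pos card_mono[OF finite_shortest_paths shortest_paths_through_subset]
    by (simp_all add: through_ratio_def A_def B_def shortest_paths_through_subset
        card_Diff_subset of_nat_diff diff_divide_distrib card_gt_0_iff)
  have le: "distance n t i j \<le> distance n s i j"
    unfolding distance_Inf using walk_mono by (intro INF_superset_mono) auto
  have "card B / card ?T \<le> card A / card ?S"
  proof (cases "B = {}")
    case False
    \<comment> \<open>A shortest path of the larger network avoiding \<open>u\<close> already exists in the smaller one,
      so the distance is the same in both.\<close>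
    then obtain p where "p \<in> B" by auto
    then have "walk n s i p j" "distance n t i j = length p"
      by (auto simp: B_def shortest_paths_def shortest_paths_through_def path_iff
          awalk_verts_with_proj_eq intro: avoid)
    then have d: "distance n t i j = distance n s i j"
      using distance_le[of n s i p j] le by auto
    then have "?S \<subseteq> ?T"
      using walk_mono by (auto simp: shortest_paths_def path_iff)
    moreover have "B \<subseteq> A"
      using d by (auto simp: A_def B_def shortest_paths_def shortest_paths_through_def path_iff
          awalk_verts_with_proj_eq intro: avoid)
    ultimately have "card ?S \<le> card ?T" "card B \<le> card A"
      by (auto simp: A_def intro!: card_mono)
    then show ?thesis
      using pos by (intro frac_le) auto
  qed simp
  then show ?thesis using eq by simp
qed

text \<open>Adjacent players are joined by a one-arc shortest path, which has no inner vertex. The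
  arcs at \<open>u\<close> are arbitrary, so the lemma covers every deviation of \<open>u\<close>
  from a complete network, even one that isolates her.\<close>

lemma betweenness_complete_off:
  assumes "\<And>i j. (i, j) \<in> pairs_avoiding n u \<Longrightarrow> adjacent n s i j"
  shows "betweenness n s u = (real n - 1) * (real n - 2)"
proof -
  have "shortest_paths_through n s u i j = {}" if ij: "(i, j) \<in> pairs_avoiding n u" for i j
  proof -
    have "distance n s i j = 1"
      using ij assms by (simp add: distance_adjacent)
    moreover have "u \<notin> set (pawalk_verts i p)" if "walk n s i p j" "length p = 1" for p
      using that ij by (auto simp: walk_iff length_Suc_conv pairs_avoiding_def)
    ultimately show ?thesis
      by (auto simp: shortest_paths_through_def shortest_paths_def path_iff
          awalk_verts_with_proj_eq one_ereal_def)
  qed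
  then have "(\<Sum>(i, j) \<in> {(i, j). i < n \<and> j < n \<and> i \<noteq> j \<and> i \<noteq> u \<and> j \<noteq> u \<and> card (shortest_paths n s i j) > 0}.
        real (card (shortest_paths_through n s u i j)) / real (card (shortest_paths n s i j))) = 0"
    by (intro sum.neutral) (auto simp: pairs_avoiding_def distinct_pairs_def)
  then show ?thesis by (simp add: betweenness_def)
qed


subsection \<open>Costs\<close>

text \<open>\<open>real_of_ereal\<close> sends \<infinity> to 0, so this is the distance only where
  the distance is finite.\<close>

abbreviation dist_real :: "nat \<Rightarrow> (nat \<Rightarrow> nat set) \<Rightarrow> nat \<Rightarrow> nat \<Rightarrow> real" where
  "dist_real n s i j \<equiv> real_of_ereal (distance n s i j)"

lemma dist_real_eq:
  "finite_distances n s \<Longrightarrow> i < n \<Longrightarrow> j < n \<Longrightarrow> distance n s i j = ereal (dist_real n s i j)"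
  by (simp add: finite_distances_def distance_eq_ereal[symmetric])

lemma dist_real_ge:
  assumes "finite_distances n s" and "(i, j) \<in> distinct_pairs n"
  shows "dist_real n s i j \<ge> (if adjacent n s i j then 1 else 2)"
proof -
  have "i \<noteq> j" "distance n s i j = ereal (dist_real n s i j)"
    using assms by (auto simp: distinct_pairs_def intro: dist_real_eq)
  with distance_ge[of i j n s] show ?thesis
    by (metis (full_types) ereal_less_eq(3) numeral_eq_ereal one_ereal_def)
qed

lemma cost_eq:
  assumes "finite_distances n s" and "u < n"
  shows "cost n b c s u = ereal (real (card (s u)) + b * betweenness n s u
    + c * (\<Sum>v\<in>{..<n} - {u}. dist_real n s u v - 1))"
proof -
  have "closeness n s u = (\<Sum>v\<in>{..<n} - {u}. ereal (dist_real n s u v - 1))"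
    unfolding closeness_def
  proof (rule sum.cong[OF refl])
    fix v assume "v \<in> {..<n} - {u}"
    then have "distance n s u v = ereal (dist_real n s u v)"
      using assms by (auto intro: dist_real_eq)
    then show "distance n s u v - 1 = ereal (dist_real n s u v - 1)"
      by (metis ereal_minus(1) one_ereal_def)
  qed
  then show ?thesis by (simp add: cost_def)
qed

text \<open>By \<open>sum_betweenness\<close>, total betweenness is a constant minus the total
  closeness, so the two weights merge into \<open>c - b\<close>.\<close>

lemma social_cost_eq:
  assumes "finite_distances n s"
  shows "social_cost n b c s = ereal ((\<Sum>u<n. real (card (s u)))
    + b * (real n * (real n - 1) * (real n - 2))
    + (c - b) * (\<Sum>(i, j)\<in>distinct_pairs n. dist_real n s i j - 1))"
proof -
  have "social_cost n b c s = ereal (\<Sum>u<n. real (card (s u)) + b * betweenness n s u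
    + c * (\<Sum>v\<in>{..<n} - {u}. dist_real n s u v - 1))"
    using assms by (simp add: social_cost_def cost_eq)
  also have "(\<Sum>u<n. real (card (s u)) + b * betweenness n s u
      + c * (\<Sum>v\<in>{..<n} - {u}. dist_real n s u v - 1))
    = (\<Sum>u<n. real (card (s u))) + b * (\<Sum>u<n. betweenness n s u)
      + c * (\<Sum>(i, j)\<in>distinct_pairs n. dist_real n s i j - 1)"
    by (simp add: sum.distrib sum_distrib_left[symmetric] sum_distinct_pairs)
  finally show ?thesis
    by (simp add: sum_betweenness[OF assms] algebra_simps)
qed

text \<open>One infinite distance makes a closeness infinite. A finite sum of extended reals is
  \<infinity> as soon as one summand is, so nothing can cancel it.\<close>

lemma social_cost_infinite:
  assumes "\<not> finite_distances n s" and "c > 0"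
  shows "social_cost n b c s = \<infinity>"
proof -
  obtain i j where ij: "i < n" "j < n" "distance n s i j = \<infinity>"
    using assms(1) by (auto simp: finite_distances_def)
  moreover have "i \<noteq> j"
    \<comment> \<open>The empty walk keeps the distance of a player to herself finite.\<close>
    using distance_le[of n s i "[]" i] ij by (auto simp: walk_iff)
  ultimately have "closeness n s i = \<infinity>"
    by (auto simp: closeness_def sum_Pinfty intro!: bexI[of _ j])
  then have "cost n b c s i = \<infinity>"
    using \<open>c > 0\<close> by (simp add: cost_def)
  then show ?thesis
    using \<open>i < n\<close> by (auto simp: social_cost_def sum_Pinfty)
qed

section \<open>Lower bound for the social cost, and its value on complete networks\<close>

lemma strategy_combinationsD: "s \<in> strategy_combinations n \<Longrightarrow> u < n \<Longrightarrow> s u \<subseteq> {..<n} - {u}"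
  by (auto simp: strategy_combinations_def strategies_def)

text \<open>Each opened channel is counted once for either order of its two players, hence the
  factor 1/2. The symmetric form lets channels be weighed against distances pair by pair.\<close>

lemma sum_card_strategies:
  assumes "s \<in> strategy_combinations n"
  shows "(\<Sum>u<n. real (card (s u)))
    = (\<Sum>(u, v)\<in>distinct_pairs n. (of_bool (v \<in> s u) + of_bool (u \<in> s v)) / 2)"
proof -
  have "(\<Sum>u<n. real (card (s u))) = (\<Sum>u<n. \<Sum>v\<in>{..<n} - {u}. of_bool (v \<in> s u))"
  proof (rule sum.cong[OF refl])
    fix u assume "u \<in> {..<n}"
    then have "({..<n} - {u}) \<inter> {v. v \<in> s u} = s u"
      using strategy_combinationsD[OF assms, of u] by auto
    then show "real (card (s u)) = (\<Sum>v\<in>{..<n} - {u}. of_bool (v \<in> s u))"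
      by (simp add: sum_of_bool_eq)
  qed
  also have "\<dots> = (\<Sum>(u, v)\<in>distinct_pairs n. of_bool (v \<in> s u))"
    by (rule sum_distinct_pairs)
  finally have 1: "(\<Sum>u<n. real (card (s u))) = (\<Sum>(u, v)\<in>distinct_pairs n. of_bool (v \<in> s u))" .
  also have "\<dots> = (\<Sum>(u, v)\<in>distinct_pairs n. of_bool (u \<in> s v))"
    by (rule sum.reindex_bij_witness[where i = prod.swap and j = prod.swap])
      (auto simp: distinct_pairs_def)
  finally have "(\<Sum>u<n. real (card (s u))) + (\<Sum>u<n. real (card (s u)))
    = (\<Sum>(u, v)\<in>distinct_pairs n. of_bool (v \<in> s u) + of_bool (u \<in> s v))"
    using 1 by (simp add: split_def sum.distrib)
  then show ?thesis
    by (simp add: split_def flip: sum_divide_distrib)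
qed

text \<open>The social cost of a complete network with every edge opened from one side: n (n - 1) /
  2 channels, maximal betweenness for every player, closeness 0.\<close>

definition complete_cost :: "nat \<Rightarrow> real \<Rightarrow> real" where
  "complete_cost n b = real n * (real n - 1) / 2 + b * (real n * (real n - 1) * (real n - 2))"

text \<open>Every ordered pair contributes at least 1/2: an adjacent one through its channel, a
  nonadjacent one through \<open>c - b \<ge> 1 / 2\<close> times a distance excess of at least 1. If
  some distance is infinite, so is the social cost.\<close>

lemma social_cost_ge:
  assumes s: "s \<in> strategy_combinations n" and "c > 0" and "c \<ge> 1 / 2 + b"
  shows "ereal (complete_cost n b) \<le> social_cost n b c s"
proof (cases "finite_distances n s")
  case True
  have "real n * (real n - 1) / 2 = (\<Sum>(u, v)\<in>distinct_pairs n. 1 / 2)"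
    by (simp add: card_distinct_pairs)
  also have "\<dots> \<le> (\<Sum>(u, v)\<in>distinct_pairs n. (of_bool (v \<in> s u) + of_bool (u \<in> s v)) / 2
      + (c - b) * (dist_real n s u v - 1))"
  proof (rule sum_mono, clarify)
    fix u v assume uv: "(u, v) \<in> distinct_pairs n"
    show "1 / 2 \<le> (of_bool (v \<in> s u) + of_bool (u \<in> s v)) / 2 + (c - b) * (dist_real n s u v - 1)"
    proof (cases "adjacent n s u v")
      case adj: True
      then have "0 \<le> (c - b) * (dist_real n s u v - 1)"
        using dist_real_ge[OF True uv] assms by simp
      with adj show ?thesis by (auto simp: adjacent_iff)
    next
      case nonadj: False
      then have "(c - b) * 1 \<le> (c - b) * (dist_real n s u v - 1)"
        using dist_real_ge[OF True uv] assms by (intro mult_left_mono) simp_all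
      moreover have "1 / 2 \<le> (c - b) * 1" using assms by simp
      ultimately have "1 / 2 \<le> (c - b) * (dist_real n s u v - 1)"
        by (rule order_trans[rotated])
      then show ?thesis by (simp add: add_increasing)
    qed
  qed
  also have "\<dots> = (\<Sum>u<n. real (card (s u)))
      + (c - b) * (\<Sum>(i, j)\<in>distinct_pairs n. dist_real n s i j - 1)"
    by (simp add: sum_card_strategies[OF s] split_def sum.distrib sum_distrib_left)
  finally show ?thesis
    by (simp add: social_cost_eq[OF True] complete_cost_def)
qed (simp add: social_cost_infinite \<open>c > 0\<close>)

lemma social_cost_complete:
  assumes s: "s \<in> strategy_combinations n"
    and once: "\<And>u v. (u, v) \<in> distinct_pairs n \<Longrightarrow> v \<in> s u \<longleftrightarrow> u \<notin> s v"
  shows "social_cost n b c s = ereal (complete_cost n b)"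
proof -
  have dist: "distance n s u v = 1" if "(u, v) \<in> distinct_pairs n" for u v
    using that once[OF that]
    by (intro distance_adjacent) (auto simp: adjacent_iff distinct_pairs_def)
  moreover have "distance n s u u \<noteq> \<infinity>" if "u < n" for u
    using distance_le[of n s u "[]" u] that by (auto simp: walk_iff)
  ultimately have "finite_distances n s"
    by (fastforce simp: finite_distances_def distinct_pairs_def one_ereal_def)
  moreover have "(\<Sum>u<n. real (card (s u))) = (\<Sum>(u, v)\<in>distinct_pairs n. 1 / 2)"
    unfolding sum_card_strategies[OF s] by (rule sum.cong) (auto simp: once)
  moreover have "(\<Sum>(i, j)\<in>distinct_pairs n. dist_real n s i j - 1) = 0"
    by (rule sum.neutral) (auto simp: dist)
  ultimately show ?thesis
    by (simp add: social_cost_eq complete_cost_def card_distinct_pairs)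
qed

subsection \<open>Equilibria\<close>

text \<open>If \<open>u\<close> opened the missing channel, she would pay 1, save at least
  \<open>c > 1\<close> in closeness, and not raise her betweenness cost, by
  \<open>through_ratio_mono\<close>.\<close>

lemma equilibrium_adjacent:
  assumes s: "s \<in> nash_equilibria n b c" and "b \<ge> 0" and "c > 1"
    and uv: "(u, v) \<in> distinct_pairs n"
  shows "adjacent n s u v"
proof (rule ccontr)
  assume nonadj: "\<not> adjacent n s u v"
  define t where "t = s(u := insert v (s u))"
  have u: "u < n" "v < n" "u \<noteq> v" using uv by (auto simp: distinct_pairs_def)
  have su: "s u \<subseteq> {..<n} - {u}"
    using s u by (auto simp: nash_equilibria_def dest!: strategy_combinationsD)
  have fs: "finite_distances n s"
    using s by (auto simp: nash_equilibria_def intro: finite_distances_of_connected)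
  have sub: "parcs (network n s) \<subseteq> parcs (network n t)"
    by (auto simp: network_def t_def)
  have le: "distance n t i j \<le> distance n s i j" for i j
    unfolding distance_Inf using sub by (intro INF_superset_mono) (auto simp: walk_iff)
  then have ft: "finite_distances n t"
    using fs unfolding finite_distances_def by (metis ereal_infty_less_eq(1))
  have "through_ratio n s u x \<le> through_ratio n t u x" if "x \<in> pairs_avoiding n u" for x
    using that fs ft sub
    by (cases x) (auto simp: pairs_avoiding_def distinct_pairs_def finite_distances_def t_def
        adjacent_iff intro!: through_ratio_mono)
  then have "betweenness n t u \<le> betweenness n s u"
    by (simp add: betweenness_eq fs ft sum_mono)
  then have "b * betweenness n t u \<le> b * betweenness n s u"
    using \<open>b \<ge> 0\<close> by (rule mult_left_mono)
  moreover have "c * (\<Sum>w\<in>{..<n} - {u}. dist_real n t u w - 1) + 1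
      < c * (\<Sum>w\<in>{..<n} - {u}. dist_real n s u w - 1)"
  proof -
    have "dist_real n t u w \<le> dist_real n s u w" if "w < n" for w
      using le[of u w] dist_real_eq[OF fs u(1) that] dist_real_eq[OF ft u(1) that]
      by (metis ereal_less_eq(3))
    moreover have "dist_real n t u v = 1"
      using u by (subst distance_adjacent) (auto simp: t_def adjacent_iff)
    moreover have "dist_real n s u v \<ge> 2"
      using dist_real_ge[OF fs uv] nonadj by simp
    \<comment> \<open>No distance from \<open>u\<close> grows, and the one to \<open>v\<close> drops
      from at least 2 to 1.\<close>
    ultimately have "dist_real n t u w - 1 \<le> dist_real n s u w - 1 - of_bool (w = v)"
      if "w < n" for w using that by auto
    then have "(\<Sum>w\<in>{..<n} - {u}. dist_real n t u w - 1)
        \<le> (\<Sum>w\<in>{..<n} - {u}. dist_real n s u w - 1 - of_bool (w = v))"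
      by (intro sum_mono) auto
    also have "\<dots> = (\<Sum>w\<in>{..<n} - {u}. dist_real n s u w - 1) - 1"
      using u by (simp add: sum_subtractf of_bool_def sum.delta)
    finally have "c * (\<Sum>w\<in>{..<n} - {u}. dist_real n t u w - 1)
        \<le> c * ((\<Sum>w\<in>{..<n} - {u}. dist_real n s u w - 1) - 1)"
      using \<open>c > 1\<close> by (intro mult_left_mono) simp_all
    then show ?thesis using \<open>c > 1\<close> by (simp add: algebra_simps)
  qed
  moreover have "card (t u) = Suc (card (s u))"
    using nonadj u finite_subset[OF su] by (auto simp: t_def adjacent_iff)
  ultimately have "cost n b c t u < cost n b c s u"
    by (simp add: cost_eq fs ft u)
  moreover have "insert v (s u) \<in> strategies n u"
    using su u by (auto simp: strategies_def)
  ultimately show False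
    using s u by (auto simp: nash_equilibria_def t_def)
qed

text \<open>Closing one of two parallel channels leaves the network unchanged and saves its
  price.\<close>

lemma equilibrium_single_channel:
  assumes s: "s \<in> nash_equilibria n b c" and uv: "(u, v) \<in> distinct_pairs n" and "v \<in> s u"
  shows "u \<notin> s v"
proof
  assume "u \<in> s v"
  define t where "t = s(u := s u - {v})"
  have u: "u < n" "v < n" "u \<noteq> v" using uv by (auto simp: distinct_pairs_def)
  have su: "s u \<subseteq> {..<n} - {u}"
    using s u by (auto simp: nash_equilibria_def dest!: strategy_combinationsD)
  \<comment> \<open>Finite costs are essential here: the saving would not show between two infinite
    costs.\<close>
  have fs: "finite_distances n s"
    using s by (auto simp: nash_equilibria_def intro: finite_distances_of_connected)
  have "network n t = network n s"
    using \<open>u \<in> s v\<close> by (auto simp: network_def t_def split: if_splits)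
  then have "distance n t = distance n s" "betweenness n t = betweenness n s"
    by (auto simp: fun_eq_iff distance_def betweenness_def shortest_paths_def
        shortest_paths_through_def)
  moreover from this fs have ft: "finite_distances n t" by (simp add: finite_distances_def)
  moreover have "card (t u) < card (s u)"
    using \<open>v \<in> s u\<close> finite_subset[OF su] by (auto simp: t_def simp del: card_Diff_insert intro!: card_Diff1_less)
  ultimately have "cost n b c t u < cost n b c s u"
    by (simp add: cost_eq fs u)
  moreover have "s u - {v} \<in> strategies n u"
    using su by (auto simp: strategies_def)
  ultimately show False
    using s u by (auto simp: nash_equilibria_def t_def)
qed

lemma social_cost_equilibrium:
  assumes "s \<in> nash_equilibria n b c" and "b \<ge> 0" and "c > 1"
  shows "social_cost n b c s = ereal (complete_cost n b)"
proof (rule social_cost_complete)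
  show "s \<in> strategy_combinations n"
    using assms by (simp add: nash_equilibria_def)
  show "v \<in> s u \<longleftrightarrow> u \<notin> s v" if "(u, v) \<in> distinct_pairs n" for u v
    using equilibrium_adjacent[OF assms that] equilibrium_single_channel[OF assms(1) that]
    by (auto simp: adjacent_iff)
qed

text \<open>The witness for the existence of an equilibrium: a complete network in which the larger
  player of each pair opens the channel. The restricted lambda makes it extensional, as
  \<open>strategy_combinations\<close> demands.\<close>

definition downward_channels :: "nat \<Rightarrow> nat \<Rightarrow> nat set" where
  "downward_channels n = (\<lambda>u\<in>{..<n}. {..<u})"

text \<open>A deviation of \<open>u\<close> leaves her betweenness alone, since the others stay
  pairwise adjacent. Each channel she saves loses her a neighbour, which costs at least
  \<open>c \<ge> 1\<close> in closeness.\<close>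

lemma downward_channels_equilibrium:
  assumes "n > 0" and "c \<ge> 1"
  shows "downward_channels n \<in> nash_equilibria n b c"
proof -
  define s where "s = downward_channels n"
  have s: "s u = {..<u}" if "u < n" for u
    using that by (simp add: s_def downward_channels_def)
  have adj: "adjacent n s u v" if "(u, v) \<in> distinct_pairs n" for u v
    using that by (auto simp: adjacent_iff s distinct_pairs_def)
  have "cost n b c s u \<le> cost n b c (s(u := t)) u" if u: "u < n" and t: "t \<in> strategies n u" for u t
  proof -
    define s' where "s' = s(u := t)"
    \<comment> \<open>The players that are no neighbours of \<open>u\<close> after the
      deviation.\<close>
    define D where "D = {v \<in> {..<n} - {u}. \<not> adjacent n s' u v}"
    have "adjacent n s' i j" if "(i, j) \<in> pairs_avoiding n u" for i j
      using that adj[of i j] by (auto simp: s'_def adjacent_iff pairs_avoiding_def)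
    moreover have "adjacent n s i j" if "(i, j) \<in> pairs_avoiding n u" for i j
      using that adj by (simp add: pairs_avoiding_def)
    ultimately have betw: "betweenness n s' u = betweenness n s u"
      by (simp add: betweenness_complete_off)
    have "closeness n s u = 0"
      unfolding closeness_def
      by (rule sum.neutral) (use u adj in \<open>auto simp: distance_adjacent distinct_pairs_def one_ereal_def\<close>)
    \<comment> \<open>Players below \<open>u\<close> open no channel to her, so each is either in
      \<open>t\<close> or lost.\<close>
    have "{..<u} \<subseteq> t \<union> D"
      using u by (auto simp: D_def s'_def adjacent_iff s)
    moreover have "finite (t \<union> D)"
      using t by (auto simp: strategies_def D_def intro: finite_subset)
    ultimately have "card (s u) \<le> card (t \<union> D)"
      unfolding s[OF u] by (intro card_mono)
    also have "\<dots> \<le> card t + card D" by (rule card_Un_le)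
    finally have card: "real (card (s u)) \<le> real (card t) + real (card D)" by simp
    \<comment> \<open>A lost player is at distance at least 2. The estimate stays in
      \<open>ereal\<close> because the deviation may isolate \<open>u\<close>.\<close>
    have "ereal (card D) = (\<Sum>v\<in>{..<n} - {u}. ereal (of_bool (\<not> adjacent n s' u v)))"
      by (simp add: D_def sum_of_bool_eq Int_def conj_ac)
    also have "\<dots> \<le> closeness n s' u"
      unfolding closeness_def
    proof (rule sum_mono)
      fix v assume "v \<in> {..<n} - {u}"
      then show "ereal (of_bool (\<not> adjacent n s' u v)) \<le> distance n s' u v - 1"
        using distance_ge[of u v n s']
        by (cases "distance n s' u v") (auto simp: one_ereal_def numeral_eq_ereal split: if_splits)
    qed
    finally have clos: "ereal (card D) \<le> closeness n s' u" .
    have "1 * ereal (card D) \<le> ereal c * closeness n s' u"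
      using clos \<open>c \<ge> 1\<close> by (intro ereal_mult_mono) (auto simp: one_ereal_def)
    then have "ereal (card t + b * betweenness n s u) + ereal (card D)
        \<le> ereal (card t + b * betweenness n s u) + ereal c * closeness n s' u"
      by (intro add_left_mono) simp
    moreover have "cost n b c s u \<le> ereal (card t + b * betweenness n s u) + ereal (card D)"
      using card \<open>closeness n s u = 0\<close> by (simp add: cost_def)
    ultimately show ?thesis
      by (simp add: cost_def betw s'_def[symmetric]) (simp add: s'_def)
  qed
  moreover have "s \<in> strategy_combinations n"
    by (auto simp: s_def downward_channels_def strategy_combinations_def strategies_def)
  ultimately show ?thesis
    using connected_complete_network[OF \<open>n > 0\<close> adj]
    by (auto simp: nash_equilibria_def not_less simp flip: s_def)
qed

theorem corollary1:
  fixes n :: nat and b c :: real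
  assumes "n \<ge> 2" and "b \<ge> 0" and "c > 1" and "c > 1 / 2 + b"
  shows "price_of_anarchy n b c = 1"
proof -
  let ?N = "nash_equilibria n b c" and ?S = "strategy_combinations n"
  let ?X = "ereal (complete_cost n b)"
  have eq: "downward_channels n \<in> ?N"
    using assms by (intro downward_channels_equilibrium) auto
  \<comment> \<open>Existence of an equilibrium makes the image nonempty, so that \<open>Max\<close>
    is taken over a singleton.\<close>
  have N: "social_cost n b c ` ?N = {?X}"
    using eq social_cost_equilibrium[OF _ assms(2,3)] by auto
  have "?N \<subseteq> ?S"
    by (auto simp: nash_equilibria_def)
  then have "?X \<in> social_cost n b c ` ?S"
    using N by blast
  moreover have "?X \<le> y" if "y \<in> social_cost n b c ` ?S" for y
    using that assms by (auto intro: social_cost_ge)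
  ultimately have "Min (social_cost n b c ` ?S) = ?X"
    by (intro Min_eqI) (simp_all add: finite_strategy_combinations)
  \<comment> \<open>The final quotient is this number divided by itself; \<open>n \<ge> 2\<close>
    keeps it away from 0.\<close>
  moreover have "complete_cost n b > 0"
    using assms by (simp add: complete_cost_def add_pos_nonneg)
  ultimately show ?thesis
    by (simp add: price_of_anarchy_def N one_ereal_def)
qed

end
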